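(* Let $X_j$, $j\geq 1$, be a collection of i.i.d. strictly positive real random variables defined on a probability space $(\Omega,\mathcal{F},P)$, with logarithmic mean $m_\ell=\exp(E[\ln X_j])$ and with $E[(\ln X_j)^2]<\infty$. Then $$\Big(\prod_{j=1}^K\frac{X_j}{m_\ell}\Big)^{1/\sqrt{K}}\rightarrow e^{X}$$ in probability as $K\to\infty$, where $X\sim N(0,\sigma_\ell^2)$ and $\sigma_\ell^2$ is the logarithmic variance of the $X_j$.
   Context: For a strictly positive real random variable $Y$ with square integrable logarithm, the logarithmic mean is $m_\ell(Y)=\exp(E[\ln Y])$ and the logarithmic variance is $\sigma_\ell^2(Y)=E[(\ln Y-\ln m_\ell(Y))^2]=\mathrm{Var}(\ln Y)$. $N(0,\sigma^2)$ denotes the Gaussian law with mean $0$ and variance $\sigma^2$.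
   Formalization: The convergence "in probability" is replaced by convergence in distribution to the law of e^X, since convergence in probability fails whenever the logarithmic variance is positive; when it is zero the two modes coincide. *)

theory Defs
  imports "HOL-Probability.Probability"
begin

definition log_mean :: "'a measure \<Rightarrow> ('a \<Rightarrow> real) \<Rightarrow> real" where
  "log_mean M Y = exp (\<integral>\<omega>. ln (Y \<omega>) \<partial>M)"

definition log_variance :: "'a measure \<Rightarrow> ('a \<Rightarrow> real) \<Rightarrow> real" where
  "log_variance M Y = (\<integral>\<omega>. (ln (Y \<omega>) - ln (log_mean M Y))\<^sup>2 \<partial>M)"

text \<open>The Gaussian law, parametrised by mean and variance. It has no Lebesgue density when the
  variance is 0, and is then the point mass at the mean. Only nonnegative variances are meaningful.\<close>

definition gaussian_law :: "real \<Rightarrow> real \<Rightarrow> real measure" where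
  "gaussian_law \<mu> v =
     (if v = 0 then return borel \<mu>
      else density lborel (\<lambda>x. ennreal (normal_density \<mu> (sqrt v) x)))"

end

theory Submission
  imports Defs
begin

text \<open>
  Taking logarithms turns the normalised product into the normalised sum
  \<open>(\<Sum>j=1..K. ln (X j) - m) / sqrt K\<close> with \<open>m = E[ln (X 1)]\<close>, that is, the normalised product
  is pointwise the exponential of this sum. The variables \<open>ln (X j)\<close> are i.i.d. and square
  integrable, so by the central limit theorem the sums converge weakly to the centred Gaussian law
  whose variance is the logarithmic variance (\<open>iid_sum_weak_conv_gaussian_law\<close>). Weak
  convergence is preserved by the continuous map \<open>exp\<close> (\<open>weak_conv_m_distr_continuous\<close>), which
  gives the claim. The value \<open>K = 0\<close> fits the same pattern: both exponents are then \<open>0\<close>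
  because division by \<open>sqrt 0\<close> yields \<open>0\<close>.

  Two adjustments connect this with the classical central limit theorem. That theorem normalises to
  unit variance, so its limit is rescaled by the standard deviation, again through the continuous
  mapping theorem; and it presupposes a positive variance. If the variance vanishes, each
  \<open>ln (X j)\<close> is almost surely equal to \<open>m\<close>, and all laws in question are point masses.
\<close>

section \<open>Continuous images of weak limits\<close>

text \<open>
  Weak convergence amounts to the convergence of the integrals of all bounded continuous functions,
  and \<open>g\<close> composed with \<open>f\<close> is such a function whenever \<open>g\<close> is.
\<close>

lemma weak_conv_m_distr_continuous:
  fixes f :: "real \<Rightarrow> real"
  assumes dists: "\<And>n. real_distribution (\<mu> n)" "real_distribution \<nu>"
    and conv: "weak_conv_m \<mu> \<nu>"
    and cont: "\<And>x. isCont f x"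
  shows "weak_conv_m (\<lambda>n. distr (\<mu> n) borel f) (distr \<nu> borel f)"
proof (rule integral_bdd_continuous_conv_imp_weak_conv)
  interpret \<mu>: real_distribution "\<mu> n" for n by (rule dists)
  interpret \<nu>: real_distribution \<nu> by (rule dists)
  have f_borel [measurable]: "f \<in> borel_measurable borel"
    using cont by (intro borel_measurable_continuous_onI continuous_at_imp_continuous_on) auto
  have f_\<mu>: "f \<in> borel_measurable (\<mu> n)" for n by measurable
  have f_\<nu>: "f \<in> borel_measurable \<nu>" by measurable
  show "real_distribution (distr (\<mu> n) borel f)" for n
    using f_\<mu> by simp
  show "real_distribution (distr \<nu> borel f)"
    using f_\<nu> by simp
  fix g :: "real \<Rightarrow> real"
  assume g: "\<And>x. isCont g x" "\<And>x. \<bar>g x\<bar> \<le> 1"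
  have [measurable]: "g \<in> borel_measurable borel"
    using g by (intro borel_measurable_continuous_onI continuous_at_imp_continuous_on) auto
  have "(\<lambda>n. \<integral>x. g (f x) \<partial>\<mu> n) \<longlonglongrightarrow> (\<integral>x. g (f x) \<partial>\<nu>)"
    using g cont
    by (intro weak_conv_imp_integral_bdd_continuous_conv[OF dists conv, where B = 1])
       (auto intro: isCont_o2)
  then show "(\<lambda>n. integral\<^sup>L (distr (\<mu> n) borel f) g) \<longlonglongrightarrow> integral\<^sup>L (distr \<nu> borel f) g"
    using f_\<mu> f_\<nu> by (simp add: integral_distr)
qed

section \<open>Independence under reindexing\<close>

lemma (in prob_space) indep_sets_reindex:
  assumes inj: "inj_on f I" and indep: "indep_sets F (f ` I)"
  shows "indep_sets (\<lambda>i. F (f i)) I"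
proof (rule indep_setsI)
  show "F (f i) \<subseteq> events" if "i \<in> I" for i
    using indep that by (auto simp: indep_sets_def)
next
  fix A J assume J: "J \<noteq> {}" "J \<subseteq> I" "finite J" and A: "\<forall>j\<in>J. A j \<in> F (f j)"
  let ?B = "\<lambda>k. A (inv_into J f k)"
  have inj_J: "inj_on f J"
    using inj J by (auto intro: inj_on_subset)
  then have B: "?B (f j) = A j" if "j \<in> J" for j
    using that by simp
  have "prob (\<Inter>k\<in>f ` J. ?B k) = (\<Prod>k\<in>f ` J. prob (?B k))"
    using indep J A B by (intro indep_setsD[OF indep]) auto
  then show "prob (\<Inter>j\<in>J. A j) = (\<Prod>j\<in>J. prob (A j))"
    using B by (simp add: prod.reindex[OF inj_J])
qed

lemma (in prob_space) indep_vars_reindex: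
  assumes "inj_on f I" "indep_vars N X (f ` I)"
  shows "indep_vars (\<lambda>i. N (f i)) (\<lambda>i. X (f i)) I"
  using assms indep_sets_reindex[OF assms(1)] unfolding indep_vars_def2 by auto

section \<open>The central limit theorem with a possibly degenerate Gaussian limit\<close>

lemma gaussian_law_eq_scaled_std_normal:
  assumes "v > 0"
  shows "gaussian_law 0 v = distr std_normal_distribution borel (\<lambda>x. sqrt v * x)"
proof -
  interpret S: real_distribution std_normal_distribution
    by (rule real_dist_normal_dist)
  have "distributed std_normal_distribution lborel (\<lambda>x. x) std_normal_density"
    by (simp add: distributed_def distr_id2)
  then have "distributed std_normal_distribution lborel (\<lambda>x. sqrt v * x) (normal_density 0 (sqrt v))"
    using assms S.normal_density_affine[of "\<lambda>x. x" 0 1 "sqrt v" 0] by simp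
  then have "distr std_normal_distribution lborel (\<lambda>x. sqrt v * x) = gaussian_law 0 v"
    using assms by (simp add: distributed_def gaussian_law_def)
  moreover have "distr std_normal_distribution lborel (\<lambda>x. sqrt v * x)
      = distr std_normal_distribution borel (\<lambda>x. sqrt v * x)"
    by (rule distr_cong) simp_all
  ultimately show ?thesis
    by simp
qed

text \<open>
  Unlike the classical statement, the sum is divided by \<open>sqrt n\<close> alone, so that the variance
  reappears in the limit law. This form remains meaningful for variance \<open>0\<close>, when the summands
  vanish almost surely and both sides are the point mass at \<open>0\<close>.
\<close>

lemma (in prob_space) iid_sum_weak_conv_gaussian_law:
  fixes Y :: "nat \<Rightarrow> 'a \<Rightarrow> real"
  assumes indep: "indep_vars (\<lambda>_. borel) Y UNIV"
    and distrib: "\<And>n. distr M borel (Y n) = distr M borel (Y 0)"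
    and sq_int: "integrable M (\<lambda>x. (Y 0 x)\<^sup>2)"
  shows "weak_conv_m
           (\<lambda>n. distr M borel (\<lambda>x. (\<Sum>i<n. Y i x - expectation (Y 0)) / sqrt (real n)))
           (gaussian_law 0 (variance (Y 0)))"
proof -
  define m where "m = expectation (Y 0)"
  define v where "v = variance (Y 0)"
  have rv [measurable]: "random_variable borel (Y n)" for n
    using indep unfolding indep_vars_def2 by simp
  have transfer: "expectation (\<lambda>x. g (Y n x)) = expectation (\<lambda>x. g (Y 0 x))"
    if [measurable]: "g \<in> borel_measurable borel" for n and g :: "real \<Rightarrow> real"
    using distrib[of n] integral_distr[of "Y n" M borel g] integral_distr[of "Y 0" M borel g]
    by simp
  have sq_int_n: "integrable M (\<lambda>x. (Y n x)\<^sup>2)" for n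
    using distrib[of n] sq_int integrable_distr_eq[of "Y n" M borel "\<lambda>y. y\<^sup>2"]
      integrable_distr_eq[of "Y 0" M borel "\<lambda>y. y\<^sup>2"] by simp
  have int: "integrable M (Y n)" for n
    by (rule square_integrable_imp_integrable[OF _ sq_int_n]) simp
  have mean: "expectation (Y n) = m" for n
    using transfer[of "\<lambda>y. y" n] by (simp add: m_def)
  have var: "expectation (\<lambda>x. (Y n x - m)\<^sup>2) = v" for n
    using transfer[of "\<lambda>y. (y - m)\<^sup>2" n] by (simp add: v_def m_def)
  have "v \<ge> 0"
    by (simp add: v_def)
  then consider "v = 0" | "v > 0" by linarith
  then have "weak_conv_m
      (\<lambda>n. distr M borel (\<lambda>x. (\<Sum>i<n. Y i x - m) / sqrt (real n))) (gaussian_law 0 v)"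
  proof cases
    case 1
    have const: "AE x in M. Y n x - m = 0" for n
    proof -
      have "integrable M (\<lambda>x. (Y n x - m)\<^sup>2)"
        using int[of n] sq_int_n[of n] by (simp add: power2_diff)
      then show ?thesis
        using var[of n] 1 integral_nonneg_eq_0_iff_AE[of M "\<lambda>x. (Y n x - m)\<^sup>2"] by simp
    qed
    have "distr M borel (\<lambda>x. (\<Sum>i<n. Y i x - m) / sqrt (real n)) = return borel 0" for n
    proof -
      have "AE x in M. \<forall>i. Y i x - m = 0"
        using const by (simp add: AE_all_countable)
      then have "AE x in M. (\<Sum>i<n. Y i x - m) / sqrt (real n) = 0"
        by eventually_elim simp
      then have "distr M borel (\<lambda>x. (\<Sum>i<n. Y i x - m) / sqrt (real n))
          = distr M borel (\<lambda>_. 0)"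
        by (intro distr_cong_AE) auto
      then show ?thesis
        by simp
    qed
    then show ?thesis
      using 1 by (simp add: gaussian_law_def weak_conv_m_def weak_conv_def)
  next
    case 2
    \<comment> \<open>Dividing by the standard deviation as well gives unit variance; the factor \<open>sqrt v\<close> is
      restored in the limit.\<close>
    let ?T = "\<lambda>n x. (\<Sum>i<n. Y i x - m) / sqrt (real n * (sqrt v)\<^sup>2)"
    have "weak_conv_m (\<lambda>n. distr M borel (?T n)) std_normal_distribution"
      using indep mean 2 sq_int_n var distrib
      by (intro central_limit_theorem[where \<mu> = "distr M borel (Y 0)"]) auto
    then have "weak_conv_m (\<lambda>n. distr (distr M borel (?T n)) borel (\<lambda>x. sqrt v * x))
        (distr std_normal_distribution borel (\<lambda>x. sqrt v * x))"
      using real_dist_normal_dist by (intro weak_conv_m_distr_continuous) auto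
    moreover have "distr (distr M borel (?T n)) borel (\<lambda>x. sqrt v * x)
        = distr M borel (\<lambda>x. (\<Sum>i<n. Y i x - m) / sqrt (real n))" for n
      using 2 by (simp add: distr_distr comp_def real_sqrt_mult)
    ultimately show ?thesis
      using 2 by (simp add: gaussian_law_eq_scaled_std_normal)
  qed
  then show ?thesis
    by (simp add: m_def v_def)
qed

section \<open>Normalised products\<close>

text \<open>
  The indices are shifted to start at \<open>0\<close>, which is where the sums in the central limit theorem
  start.
\<close>

lemma normalised_prod_eq_exp_sum:
  fixes x :: "nat \<Rightarrow> real"
  assumes "\<And>j. j \<ge> 1 \<Longrightarrow> x j > 0"
  shows "(\<Prod>j=1..K. x j / exp m) powr (1 / sqrt (real K))
       = exp ((\<Sum>i<K. ln (x (Suc i)) - m) / sqrt (real K))"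
proof -
  have "(\<Prod>j=1..K. x j / exp m) = (\<Prod>i<K. x (Suc i) / exp m)"
    by (simp add: prod.atLeast1_atMost_eq)
  also have "\<dots> = (\<Prod>i<K. exp (ln (x (Suc i)) - m))"
    using assms by (simp add: exp_diff)
  also have "\<dots> = exp (\<Sum>i<K. ln (x (Suc i)) - m)"
    by (simp add: exp_sum)
  finally show ?thesis
    by (simp add: powr_def)
qed

theorem theorem4p3:
  fixes M :: "'a measure" and X :: "nat \<Rightarrow> 'a \<Rightarrow> real"
    and N :: "'b measure" and Z :: "'b \<Rightarrow> real"
  assumes "prob_space M"
    and "prob_space.indep_vars M (\<lambda>_. borel) X {1..}"
    and "\<And>i j. i \<ge> 1 \<Longrightarrow> j \<ge> 1 \<Longrightarrow> distr M borel (X i) = distr M borel (X j)"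
    and "\<And>j \<omega>. j \<ge> 1 \<Longrightarrow> \<omega> \<in> space M \<Longrightarrow> X j \<omega> > 0"
    and "\<And>j. j \<ge> 1 \<Longrightarrow> integrable M (\<lambda>\<omega>. (ln (X j \<omega>))\<^sup>2)"
    and "prob_space N"
    and "Z \<in> borel_measurable N"
    and "distr N borel Z = gaussian_law 0 (log_variance M (X 1))"
  shows "weak_conv_m
           (\<lambda>K. distr M borel
              (\<lambda>\<omega>. (\<Prod>j=1..K. X j \<omega> / log_mean M (X 1)) powr (1 / sqrt (real K))))
           (distr N borel (\<lambda>\<omega>. exp (Z \<omega>)))"
proof -
  interpret M: prob_space M by (rule assms(1))
  interpret N: prob_space N by (rule assms(6))
  note [measurable] = assms(7)
  define Y where "Y i \<omega> = ln (X (Suc i) \<omega>)" for i \<omega>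
  define m where "m = M.expectation (Y 0)"
  let ?S = "\<lambda>K \<omega>. (\<Sum>i<K. Y i \<omega> - m) / sqrt (real K)"
  have X_rv [measurable]: "X (Suc i) \<in> borel_measurable M" for i
    using assms(2) unfolding M.indep_vars_def2 by simp
  have Y_rv [measurable]: "Y i \<in> borel_measurable M" for i
    unfolding Y_def by measurable
  have "M.indep_vars (\<lambda>_. borel) X (range Suc)"
    by (rule M.indep_vars_subset[OF assms(2)]) auto
  then have "M.indep_vars (\<lambda>_. borel) (\<lambda>i. X (Suc i)) UNIV"
    by (rule M.indep_vars_reindex[of Suc UNIV "\<lambda>_. borel" X, OF inj_Suc])
  then have indep: "M.indep_vars (\<lambda>_. borel) Y UNIV"
    unfolding Y_def[abs_def] by (rule M.indep_vars_compose2) simp_all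
  have "distr M borel (Y n) = distr (distr M borel (X (Suc n))) borel ln" for n
    by (simp add: distr_distr comp_def Y_def[abs_def])
  then have distrib: "distr M borel (Y n) = distr M borel (Y 0)" for n
    using assms(3)[of "Suc n" "Suc 0"] by simp
  have log_mean: "log_mean M (X 1) = exp m"
    by (simp add: log_mean_def m_def Y_def[abs_def])
  then have variance: "M.expectation (\<lambda>\<omega>. (Y 0 \<omega> - m)\<^sup>2) = log_variance M (X 1)"
    by (simp add: log_variance_def Y_def[abs_def])
  have "weak_conv_m (\<lambda>K. distr M borel (?S K)) (distr N borel Z)"
    using M.iid_sum_weak_conv_gaussian_law[OF indep distrib] assms(5)[of 1] assms(8) variance
    by (simp add: Y_def[abs_def] m_def)
  then have "weak_conv_m (\<lambda>K. distr (distr M borel (?S K)) borel exp)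
      (distr (distr N borel Z) borel exp)"
    by (intro weak_conv_m_distr_continuous) auto
  moreover have "distr (distr N borel Z) borel exp = distr N borel (\<lambda>\<omega>. exp (Z \<omega>))"
    by (simp add: distr_distr comp_def)
  moreover have "distr (distr M borel (?S K)) borel exp = distr M borel
      (\<lambda>\<omega>. (\<Prod>j=1..K. X j \<omega> / log_mean M (X 1)) powr (1 / sqrt (real K)))" for K
  proof -
    have "exp (?S K \<omega>) = (\<Prod>j=1..K. X j \<omega> / log_mean M (X 1)) powr (1 / sqrt (real K))"
      if "\<omega> \<in> space M" for \<omega>
      using normalised_prod_eq_exp_sum[of "\<lambda>j. X j \<omega>" m K] assms(4) that
      unfolding log_mean Y_def by simp
    then show ?thesis
      by (subst distr_distr) (auto simp: comp_def intro: distr_cong)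
  qed
  ultimately show ?thesis
    by simp
qed

end
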